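(* Let $R$ be a ring and let $M$ be an endo-coprime left $R$-module. Then: (1) $M$ cannot have a nontrivial (i.e. different from $0$ and $M$) fully invariant submodule which is a direct summand of $M$; consequently $R/\mathrm{Ann}_R(M)$ has no nontrivial central idempotents. (2) If $M=K\oplus L$ for non-zero submodules $K$ and $L$ of $M$, then $\mathrm{Hom}_R(K,L)\neq 0$. (3) If $M$ is coretractable, then every proper fully invariant submodule $N\subset M$ is superfluous in $M$ and $M/N$ is coretractable. (4) If $M$ is self-projective, then for every proper fully invariant submodule $N\subset M$, $M/N$ is endo-coprime. (5) $M$ is Dedekind finite if and only if there exists a proper fully invariant submodule $N\subset M$ for which $M/N$ is Dedekind finite. (6) If $M$ is semi-projective, then the center of $S=\mathrm{End}_R(M)$ is a field.
   Context: Rings are associative with non-zero identity, modules are unital and $M$ is non-zero. Endomorphisms of left modules are written on the right of their arguments, so $fg$ means first $f$, then $g$. With $S=\mathrm{End}_R(M)$, a submodule $K$ of $M$ is fully invariant if $(K)f\subseteq K$ for all $f\in S$. $M$ is endo-coprime if for every proper fully invariant submodule $K$ of $M$, $\mathrm{Ann}_S(M/K)=\{f\in S\mid (M)f\subseteq K\}=0$. $M$ is coretractable if for every proper submodule $K$ of $M$ there is a non-zero $f\in S$ with $(K)f=0$. A submodule $N$ is superfluous in $M$ if $N+K=M$ implies $K=M$ for every submodule $K$ of $M$. $M$ is self-projective if it is $M$-projective. $M$ is Dedekind finite if its endomorphism ring is Dedekind finite ($fg=1$ implies $gf=1$). $M$ is semi-projective if for every $f\in S$, $Sf=\{g\in S\mid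 (M)g\subseteq (M)f\}$. *)

theory Defs
  imports "HOL-Algebra.Module" "HOL-Algebra.QuotRing"
begin

text \<open>
  The library locale \<^locale>\<open>module\<close> requires a commutative ring of scalars.  The same record
  type and the same axioms are used here over an arbitrary ring; the \<open>mult\<close> and \<open>one\<close> fields of
  the module record carry no meaning.
\<close>

locale left_module = R?: ring R + M?: abelian_group M
  for R :: "('a, 'r) ring_scheme" (structure) and M :: "('a, 'b, 'm) module_scheme" (structure) +
  assumes smult_closed [simp, intro]:
      "\<lbrakk>a \<in> carrier R; x \<in> carrier M\<rbrakk> \<Longrightarrow> a \<odot>\<^bsub>M\<^esub> x \<in> carrier M"
    and smult_l_distr:
      "\<lbrakk>a \<in> carrier R; b \<in> carrier R; x \<in> carrier M\<rbrakk> \<Longrightarrow>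
        (a \<oplus> b) \<odot>\<^bsub>M\<^esub> x = a \<odot>\<^bsub>M\<^esub> x \<oplus>\<^bsub>M\<^esub> b \<odot>\<^bsub>M\<^esub> x"
    and smult_r_distr:
      "\<lbrakk>a \<in> carrier R; x \<in> carrier M; y \<in> carrier M\<rbrakk> \<Longrightarrow>
        a \<odot>\<^bsub>M\<^esub> (x \<oplus>\<^bsub>M\<^esub> y) = a \<odot>\<^bsub>M\<^esub> x \<oplus>\<^bsub>M\<^esub> a \<odot>\<^bsub>M\<^esub> y"
    and smult_assoc1:
      "\<lbrakk>a \<in> carrier R; b \<in> carrier R; x \<in> carrier M\<rbrakk> \<Longrightarrow>
        (a \<otimes> b) \<odot>\<^bsub>M\<^esub> x = a \<odot>\<^bsub>M\<^esub> (b \<odot>\<^bsub>M\<^esub> x)"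
    and smult_one [simp]: "x \<in> carrier M \<Longrightarrow> \<one> \<odot>\<^bsub>M\<^esub> x = x"

definition quot_module :: "('a, 'b, 'm) module_scheme \<Rightarrow> 'b set \<Rightarrow> ('a, 'b set) module"
  where "quot_module M N =
    \<lparr>carrier = a_rcosets\<^bsub>M\<^esub> N, mult = undefined, one = undefined, zero = N, add = set_add M,
     smult = (\<lambda>r X. \<Union>x\<in>X. N +>\<^bsub>M\<^esub> (r \<odot>\<^bsub>M\<^esub> x))\<rparr>"

text \<open>
  Homomorphisms are extensional functions (undefined off the carrier), so that equality of
  homomorphisms is equality of functions.
\<close>

definition mod_hom :: "('a, 'r) ring_scheme \<Rightarrow> ('a, 'b, 'm) module_scheme
    \<Rightarrow> ('a, 'c, 'n) module_scheme \<Rightarrow> ('b \<Rightarrow> 'c) set"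
  where "mod_hom R M N = {f \<in> carrier M \<rightarrow>\<^sub>E carrier N.
    (\<forall>x\<in>carrier M. \<forall>y\<in>carrier M. f (x \<oplus>\<^bsub>M\<^esub> y) = f x \<oplus>\<^bsub>N\<^esub> f y) \<and>
    (\<forall>r\<in>carrier R. \<forall>x\<in>carrier M. f (r \<odot>\<^bsub>M\<^esub> x) = r \<odot>\<^bsub>N\<^esub> f x)}"

definition zero_hom :: "('a, 'b, 'm) module_scheme \<Rightarrow> ('a, 'c, 'n) module_scheme \<Rightarrow> 'b \<Rightarrow> 'c"
  where "zero_hom M N = (\<lambda>x\<in>carrier M. \<zero>\<^bsub>N\<^esub>)"

text \<open>
  Endomorphisms of left modules act on the right: the product \<open>f \<otimes> g\<close> is \<open>f\<close> followed by \<open>g\<close>.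
\<close>

definition End_ring :: "('a, 'r) ring_scheme \<Rightarrow> ('a, 'b, 'm) module_scheme \<Rightarrow> ('b \<Rightarrow> 'b) ring"
  where "End_ring R M =
    \<lparr>carrier = mod_hom R M M,
     mult = (\<lambda>f g. \<lambda>x\<in>carrier M. g (f x)),
     one = (\<lambda>x\<in>carrier M. x),
     zero = zero_hom M M,
     add = (\<lambda>f g. \<lambda>x\<in>carrier M. f x \<oplus>\<^bsub>M\<^esub> g x)\<rparr>"

definition annihilator :: "('a, 'r) ring_scheme \<Rightarrow> ('a, 'b, 'm) module_scheme \<Rightarrow> 'a set"
  where "annihilator R M = {r \<in> carrier R. \<forall>x\<in>carrier M. r \<odot>\<^bsub>M\<^esub> x = \<zero>\<^bsub>M\<^esub>}"

text \<open>The annihilator in \<open>End_ring R M\<close> of the quotient of \<open>M\<close> by \<open>K\<close>.\<close>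

definition End_annihilator ::
    "('a, 'r) ring_scheme \<Rightarrow> ('a, 'b, 'm) module_scheme \<Rightarrow> 'b set \<Rightarrow> ('b \<Rightarrow> 'b) set"
  where "End_annihilator R M K = {f \<in> carrier (End_ring R M). f ` carrier M \<subseteq> K}"

definition fully_invariant ::
    "('a, 'r) ring_scheme \<Rightarrow> ('a, 'b, 'm) module_scheme \<Rightarrow> 'b set \<Rightarrow> bool"
  where "fully_invariant R M K \<longleftrightarrow>
    submodule K R M \<and> (\<forall>f\<in>carrier (End_ring R M). f ` K \<subseteq> K)"

definition endo_coprime :: "('a, 'r) ring_scheme \<Rightarrow> ('a, 'b, 'm) module_scheme \<Rightarrow> bool"
  where "endo_coprime R M \<longleftrightarrow>
    (\<forall>K. fully_invariant R M K \<and> K \<noteq> carrier M \<longrightarrow>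
      End_annihilator R M K = {\<zero>\<^bsub>End_ring R M\<^esub>})"

definition coretractable :: "('a, 'r) ring_scheme \<Rightarrow> ('a, 'b, 'm) module_scheme \<Rightarrow> bool"
  where "coretractable R M \<longleftrightarrow>
    (\<forall>K. submodule K R M \<and> K \<noteq> carrier M \<longrightarrow>
      (\<exists>f\<in>carrier (End_ring R M). f \<noteq> \<zero>\<^bsub>End_ring R M\<^esub> \<and> f ` K = {\<zero>\<^bsub>M\<^esub>}))"

definition superfluous ::
    "('a, 'r) ring_scheme \<Rightarrow> ('a, 'b, 'm) module_scheme \<Rightarrow> 'b set \<Rightarrow> bool"
  where "superfluous R M N \<longleftrightarrow>
    submodule N R M \<and>
    (\<forall>K. submodule K R M \<and> N <+>\<^bsub>M\<^esub> K = carrier M \<longrightarrow> K = carrier M)"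

definition internal_direct_sum ::
    "('a, 'r) ring_scheme \<Rightarrow> ('a, 'b, 'm) module_scheme \<Rightarrow> 'b set \<Rightarrow> 'b set \<Rightarrow> bool"
  where "internal_direct_sum R M K L \<longleftrightarrow>
    submodule K R M \<and> submodule L R M \<and> K <+>\<^bsub>M\<^esub> L = carrier M \<and> K \<inter> L = {\<zero>\<^bsub>M\<^esub>}"

definition direct_summand ::
    "('a, 'r) ring_scheme \<Rightarrow> ('a, 'b, 'm) module_scheme \<Rightarrow> 'b set \<Rightarrow> bool"
  where "direct_summand R M K \<longleftrightarrow> (\<exists>L. internal_direct_sum R M K L)"

text \<open>
  \<open>rel_projective R P M\<close>: the module \<open>P\<close> is \<open>M\<close>-projective, that is, homomorphisms from \<open>P\<close> lift
  along every epimorphism \<open>g : M \<rightarrow> N\<close>.  A definition cannot quantify over all types, so \<open>N\<close>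
  ranges over the modules whose elements have type \<^typ>\<open>'b set\<close>; up to isomorphism this covers
  every epimorphic image of \<open>M\<close>, since all the modules \<open>quot_module M K\<close> are of this type.
\<close>

definition rel_projective ::
    "('a, 'r) ring_scheme \<Rightarrow> ('a, 'c, 'p) module_scheme \<Rightarrow> ('a, 'b, 'm) module_scheme \<Rightarrow> bool"
  where "rel_projective R P M \<longleftrightarrow>
    (\<forall>N :: ('a, 'b set) module. left_module R N \<longrightarrow>
      (\<forall>g\<in>mod_hom R M N. g ` carrier M = carrier N \<longrightarrow>
        (\<forall>f\<in>mod_hom R P N. \<exists>h\<in>mod_hom R P M. \<forall>x\<in>carrier P. g (h x) = f x)))"

definition self_projective :: "('a, 'r) ring_scheme \<Rightarrow> ('a, 'b, 'm) module_scheme \<Rightarrow> bool"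
  where "self_projective R M \<longleftrightarrow> rel_projective R M M"

definition semi_projective :: "('a, 'r) ring_scheme \<Rightarrow> ('a, 'b, 'm) module_scheme \<Rightarrow> bool"
  where "semi_projective R M \<longleftrightarrow>
    (\<forall>f\<in>carrier (End_ring R M).
      {s \<otimes>\<^bsub>End_ring R M\<^esub> f | s. s \<in> carrier (End_ring R M)} =
      {g \<in> carrier (End_ring R M). g ` carrier M \<subseteq> f ` carrier M})"

definition dedekind_finite_ring :: "('a, 'r) ring_scheme \<Rightarrow> bool"
  where "dedekind_finite_ring S \<longleftrightarrow>
    (\<forall>f\<in>carrier S. \<forall>g\<in>carrier S. f \<otimes>\<^bsub>S\<^esub> g = \<one>\<^bsub>S\<^esub> \<longrightarrow> g \<otimes>\<^bsub>S\<^esub> f = \<one>\<^bsub>S\<^esub>)"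

definition dedekind_finite :: "('a, 'r) ring_scheme \<Rightarrow> ('a, 'b, 'm) module_scheme \<Rightarrow> bool"
  where "dedekind_finite R M \<longleftrightarrow> dedekind_finite_ring (End_ring R M)"

definition center :: "('a, 'r) ring_scheme \<Rightarrow> 'a set"
  where "center S = {z \<in> carrier S. \<forall>s\<in>carrier S. z \<otimes>\<^bsub>S\<^esub> s = s \<otimes>\<^bsub>S\<^esub> z}"

definition central_idempotent :: "('a, 'r) ring_scheme \<Rightarrow> 'a \<Rightarrow> bool"
  where "central_idempotent S e \<longleftrightarrow> e \<in> center S \<and> e \<otimes>\<^bsub>S\<^esub> e = e"

lemma (in left_module) smult_r_null [simp]:
  assumes "a \<in> carrier R" shows "a \<odot>\<^bsub>M\<^esub> \<zero>\<^bsub>M\<^esub> = \<zero>\<^bsub>M\<^esub>"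
  using smult_r_distr[of a "\<zero>\<^bsub>M\<^esub>" "\<zero>\<^bsub>M\<^esub>"] assms
  by (metis M.add.r_cancel_one' M.r_zero M.zero_closed smult_closed)

lemma (in left_module) smult_l_null [simp]:
  assumes "x \<in> carrier M" shows "\<zero> \<odot>\<^bsub>M\<^esub> x = \<zero>\<^bsub>M\<^esub>"
  using smult_l_distr[of \<zero> \<zero> x] assms
  by (metis M.add.r_cancel_one' R.r_zero R.zero_closed smult_closed)

lemma (in left_module) quot_smult:
  assumes N: "submodule N R M" and r: "r \<in> carrier R" and x: "x \<in> carrier M"
  shows "r \<odot>\<^bsub>quot_module M N\<^esub> (N +>\<^bsub>M\<^esub> x) = N +>\<^bsub>M\<^esub> (r \<odot>\<^bsub>M\<^esub> x)"
proof -
  have "subgroup N (add_monoid M)" using N by (rule submodule.axioms)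
  then interpret S: abelian_subgroup N M
    by (intro abelian_subgroupI3 additive_subgroup.intro M.abelian_group_axioms)
  have "N +>\<^bsub>M\<^esub> (r \<odot>\<^bsub>M\<^esub> y) = N +>\<^bsub>M\<^esub> (r \<odot>\<^bsub>M\<^esub> x)" if y: "y \<in> N +>\<^bsub>M\<^esub> x" for y
  proof -
    obtain n where n: "n \<in> N" "y = n \<oplus>\<^bsub>M\<^esub> x"
      using y unfolding a_r_coset_def' by blast
    have nM: "n \<in> carrier M" using n S.a_subset by blast
    have "r \<odot>\<^bsub>M\<^esub> y = r \<odot>\<^bsub>M\<^esub> n \<oplus>\<^bsub>M\<^esub> r \<odot>\<^bsub>M\<^esub> x"
      unfolding n(2) using r nM x by (rule smult_r_distr)
    moreover have "r \<odot>\<^bsub>M\<^esub> n \<in> N" using N r n(1) by (rule submodule.smult_closed)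
    ultimately have "r \<odot>\<^bsub>M\<^esub> y \<in> N +>\<^bsub>M\<^esub> (r \<odot>\<^bsub>M\<^esub> x)" unfolding a_r_coset_def' by blast
    then show ?thesis
      using S.a_repr_independence'[OF _ smult_closed[OF r x]] by simp
  qed
  moreover have "x \<in> N +>\<^bsub>M\<^esub> x" using x by (rule S.a_rcos_self)
  ultimately have "(\<Union>y\<in>N +>\<^bsub>M\<^esub> x. N +>\<^bsub>M\<^esub> (r \<odot>\<^bsub>M\<^esub> y)) = N +>\<^bsub>M\<^esub> (r \<odot>\<^bsub>M\<^esub> x)" by blast
  then show ?thesis by (simp only: quot_module_def module.simps)
qed

lemma (in left_module) quot_module_left_module:
  assumes N: "submodule N R M"
  shows "left_module R (quot_module M N)"
proof -
  have "subgroup N (add_monoid M)" using N by (rule submodule.axioms)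
  then interpret S: abelian_subgroup N M
    by (intro abelian_subgroupI3 additive_subgroup.intro M.abelian_group_axioms)
  let ?Q = "quot_module M N"
  have Q: "carrier ?Q = a_rcosets\<^bsub>M\<^esub> N" "\<zero>\<^bsub>?Q\<^esub> = N" "X \<oplus>\<^bsub>?Q\<^esub> Y = X <+>\<^bsub>M\<^esub> Y" for X Y
    by (simp_all add: quot_module_def)
  have rep: "\<exists>x\<in>carrier M. X = N +>\<^bsub>M\<^esub> x" if "X \<in> carrier ?Q" for X
    using that unfolding Q A_RCOSETS_def' by auto
  have inQ: "N +>\<^bsub>M\<^esub> x \<in> carrier ?Q" if "x \<in> carrier M" for x
    using that by (simp add: Q M.a_rcosetsI S.a_subset)
  have add: "(N +>\<^bsub>M\<^esub> x) \<oplus>\<^bsub>?Q\<^esub> (N +>\<^bsub>M\<^esub> y) = N +>\<^bsub>M\<^esub> (x \<oplus>\<^bsub>M\<^esub> y)"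
    if "x \<in> carrier M" "y \<in> carrier M" for x y
    using that by (simp add: Q S.a_rcos_sum)
  have zero: "\<zero>\<^bsub>?Q\<^esub> = N +>\<^bsub>M\<^esub> \<zero>\<^bsub>M\<^esub>"
    by (simp add: Q S.a_subset)
  note sm = quot_smult[OF N]
  have "abelian_group ?Q"
  proof (rule abelian_groupI)
    show "\<exists>Y\<in>carrier ?Q. Y \<oplus>\<^bsub>?Q\<^esub> X = \<zero>\<^bsub>?Q\<^esub>" if X: "X \<in> carrier ?Q" for X
    proof -
      from rep[OF X] obtain x where "x \<in> carrier M" "X = N +>\<^bsub>M\<^esub> x" by blast
      then show ?thesis
        by (intro bexI[of _ "N +>\<^bsub>M\<^esub> (\<ominus>\<^bsub>M\<^esub> x)"]) (auto simp: add zero inQ M.l_neg)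
    qed
  next
    fix X Y Z assume "X \<in> carrier ?Q" "Y \<in> carrier ?Q" "Z \<in> carrier ?Q"
    then obtain x y z where "x \<in> carrier M" "X = N +>\<^bsub>M\<^esub> x" "y \<in> carrier M" "Y = N +>\<^bsub>M\<^esub> y"
      "z \<in> carrier M" "Z = N +>\<^bsub>M\<^esub> z" using rep by metis
    then show "X \<oplus>\<^bsub>?Q\<^esub> Y \<oplus>\<^bsub>?Q\<^esub> Z = X \<oplus>\<^bsub>?Q\<^esub> (Y \<oplus>\<^bsub>?Q\<^esub> Z)" by (simp add: add M.a_assoc)
  next
    fix X Y assume "X \<in> carrier ?Q" "Y \<in> carrier ?Q"
    then obtain x y where xy: "x \<in> carrier M" "X = N +>\<^bsub>M\<^esub> x" "y \<in> carrier M" "Y = N +>\<^bsub>M\<^esub> y"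
      using rep by metis
    then show "X \<oplus>\<^bsub>?Q\<^esub> Y \<in> carrier ?Q" by (simp add: add inQ)
    from xy show "X \<oplus>\<^bsub>?Q\<^esub> Y = Y \<oplus>\<^bsub>?Q\<^esub> X" by (simp add: add M.a_comm)
  next
    fix X assume "X \<in> carrier ?Q"
    then obtain x where "x \<in> carrier M" "X = N +>\<^bsub>M\<^esub> x" using rep by blast
    then show "\<zero>\<^bsub>?Q\<^esub> \<oplus>\<^bsub>?Q\<^esub> X = X" by (simp add: zero add)
  next
    show "\<zero>\<^bsub>?Q\<^esub> \<in> carrier ?Q" by (simp add: zero inQ)
  qed
  moreover have "left_module_axioms R ?Q"
  proof (rule left_module_axioms.intro)
    fix X assume "X \<in> carrier ?Q"
    then obtain x where X: "x \<in> carrier M" "X = N +>\<^bsub>M\<^esub> x" using rep by blast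
    then show "\<one> \<odot>\<^bsub>?Q\<^esub> X = X" by (simp add: sm)
    fix a assume a: "a \<in> carrier R"
    with X show "a \<odot>\<^bsub>?Q\<^esub> X \<in> carrier ?Q" by (simp add: sm inQ)
    { fix b assume b: "b \<in> carrier R"
      with X a show "(a \<oplus> b) \<odot>\<^bsub>?Q\<^esub> X = a \<odot>\<^bsub>?Q\<^esub> X \<oplus>\<^bsub>?Q\<^esub> b \<odot>\<^bsub>?Q\<^esub> X"
        by (simp add: sm add smult_l_distr)
      from X a b show "(a \<otimes> b) \<odot>\<^bsub>?Q\<^esub> X = a \<odot>\<^bsub>?Q\<^esub> (b \<odot>\<^bsub>?Q\<^esub> X)"
        by (simp add: sm smult_assoc1) }
    fix Y assume "Y \<in> carrier ?Q"
    then obtain y where Y: "y \<in> carrier M" "Y = N +>\<^bsub>M\<^esub> y" using rep by blast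
    with X a show "a \<odot>\<^bsub>?Q\<^esub> (X \<oplus>\<^bsub>?Q\<^esub> Y) = a \<odot>\<^bsub>?Q\<^esub> X \<oplus>\<^bsub>?Q\<^esub> a \<odot>\<^bsub>?Q\<^esub> Y"
      by (simp add: sm add smult_r_distr)
  qed
  ultimately show ?thesis by (simp add: left_module_def R.ring_axioms)
qed

lemma (in left_module) End_ring_ring: "ring (End_ring R M)"
proof -
  let ?S = "End_ring R M"
  have S: "carrier ?S = mod_hom R M M" "\<zero>\<^bsub>?S\<^esub> = (\<lambda>x\<in>carrier M. \<zero>\<^bsub>M\<^esub>)"
    "\<one>\<^bsub>?S\<^esub> = (\<lambda>x\<in>carrier M. x)"
    "f \<oplus>\<^bsub>?S\<^esub> g = (\<lambda>x\<in>carrier M. f x \<oplus>\<^bsub>M\<^esub> g x)"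
    "f \<otimes>\<^bsub>?S\<^esub> g = (\<lambda>x\<in>carrier M. g (f x))" for f g
    by (simp_all add: End_ring_def zero_hom_def)
  have cl: "f x \<in> carrier M" if "f \<in> mod_hom R M M" "x \<in> carrier M" for f x
    using that by (auto simp: mod_hom_def)
  have hom: "f (x \<oplus>\<^bsub>M\<^esub> y) = f x \<oplus>\<^bsub>M\<^esub> f y" "a \<in> carrier R \<Longrightarrow> f (a \<odot>\<^bsub>M\<^esub> x) = a \<odot>\<^bsub>M\<^esub> f x"
    if "f \<in> mod_hom R M M" "x \<in> carrier M" "y \<in> carrier M" for f a x y
    using that by (auto simp: mod_hom_def)
  have ext: "f = g" if "f \<in> mod_hom R M M" "g \<in> mod_hom R M M"
      "\<And>x. x \<in> carrier M \<Longrightarrow> f x = g x" for f g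
    using that by (auto simp: mod_hom_def intro: PiE_ext)
  have I: "(\<lambda>x\<in>carrier M. f x) \<in> mod_hom R M M"
    if "\<And>x. x \<in> carrier M \<Longrightarrow> f x \<in> carrier M"
      "\<And>x y. \<lbrakk>x \<in> carrier M; y \<in> carrier M\<rbrakk> \<Longrightarrow> f (x \<oplus>\<^bsub>M\<^esub> y) = f x \<oplus>\<^bsub>M\<^esub> f y"
      "\<And>a x. \<lbrakk>a \<in> carrier R; x \<in> carrier M\<rbrakk> \<Longrightarrow> f (a \<odot>\<^bsub>M\<^esub> x) = a \<odot>\<^bsub>M\<^esub> f x" for f
    using that by (auto simp: mod_hom_def)
  have neg: "\<ominus>\<^bsub>M\<^esub> (a \<odot>\<^bsub>M\<^esub> x) = a \<odot>\<^bsub>M\<^esub> (\<ominus>\<^bsub>M\<^esub> x)" if "a \<in> carrier R" "x \<in> carrier M" for a x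
    using that by (metis M.a_inv_closed M.minus_equality M.l_neg smult_closed smult_r_distr smult_r_null)
  have clz: "\<zero>\<^bsub>?S\<^esub> \<in> mod_hom R M M" "\<one>\<^bsub>?S\<^esub> \<in> mod_hom R M M"
    unfolding S by (rule I; simp)+
  have cla: "f \<oplus>\<^bsub>?S\<^esub> g \<in> mod_hom R M M" if "f \<in> mod_hom R M M" "g \<in> mod_hom R M M" for f g
    unfolding S by (rule I) (simp_all add: that cl hom smult_r_distr M.a_ac)
  have clm: "f \<otimes>\<^bsub>?S\<^esub> g \<in> mod_hom R M M" if "f \<in> mod_hom R M M" "g \<in> mod_hom R M M" for f g
    unfolding S by (rule I) (simp_all add: that cl hom)
  have cln: "(\<lambda>x\<in>carrier M. \<ominus>\<^bsub>M\<^esub> f x) \<in> mod_hom R M M" if "f \<in> mod_hom R M M" for f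
    by (rule I) (simp_all add: that cl hom neg M.minus_add)
  have ap: "\<zero>\<^bsub>?S\<^esub> x = \<zero>\<^bsub>M\<^esub>" "\<one>\<^bsub>?S\<^esub> x = x" "(f \<oplus>\<^bsub>?S\<^esub> g) x = f x \<oplus>\<^bsub>M\<^esub> g x" "(f \<otimes>\<^bsub>?S\<^esub> g) x = g (f x)"
    if "x \<in> carrier M" for f g x
    using that by (simp_all add: S)
  note rules = S(1) clz cla clm cl ap
  show ?thesis
  proof (rule ringI)
    show "abelian_group ?S"
    proof (rule abelian_groupI)
      show "\<exists>g\<in>carrier ?S. g \<oplus>\<^bsub>?S\<^esub> f = \<zero>\<^bsub>?S\<^esub>" if "f \<in> carrier ?S" for f
      proof -
        have f: "f \<in> mod_hom R M M" using that by (simp add: S)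
        have "(\<lambda>x\<in>carrier M. \<ominus>\<^bsub>M\<^esub> f x) \<oplus>\<^bsub>?S\<^esub> f = \<zero>\<^bsub>?S\<^esub>"
          by (rule ext) (simp_all add: rules cln f M.l_neg)
        then show ?thesis using cln[OF f] S(1) by blast
      qed
    qed (simp_all add: rules, (rule ext; simp add: rules M.a_ac)+)
    show "monoid ?S"
      by (rule monoidI) (simp_all add: rules, (rule ext; simp add: rules)+)
  qed (simp_all add: rules, (rule ext; simp add: rules hom)+)
qed

lemma (in left_module) annihilator_ideal: "ideal (annihilator R M) R"
proof -
  have neg: "\<ominus> a \<in> annihilator R M" if "a \<in> annihilator R M" for a
  proof -
    have a: "a \<in> carrier R" "\<And>x. x \<in> carrier M \<Longrightarrow> a \<odot>\<^bsub>M\<^esub> x = \<zero>\<^bsub>M\<^esub>"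
      using that by (auto simp: annihilator_def)
    have "(\<ominus> a) \<odot>\<^bsub>M\<^esub> x = \<zero>\<^bsub>M\<^esub>" if "x \<in> carrier M" for x
      using smult_l_distr[of "\<ominus> a" a x] a that by (simp add: R.l_neg)
    then show ?thesis using a by (simp add: annihilator_def)
  qed
  have "\<zero> \<in> annihilator R M" by (simp add: annihilator_def)
  then have "subgroup (annihilator R M) (add_monoid R)"
    by (intro R.add.subgroupI neg)
      (auto simp: annihilator_def smult_l_distr)
  then show ?thesis
    by (rule idealI[OF R.ring_axioms]) (simp_all add: annihilator_def smult_assoc1)
qed

end

theory Submission
  imports Defs "HOL-Algebra.Subrings"
begin

text \<open>
  Everything rests on one consequence of endo-coprimeness: an endomorphism of \<open>M\<close> whose image
  lies in a proper fully invariant submodule is zero (\<open>endo_coprime_eq_zero\<close>); equivalently, two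
  endomorphisms that agree modulo such a submodule are equal (\<open>endo_coprime_eqI\<close>).  Each part of
  the theorem comes from a suitable endomorphism.

  \<^item> The projection onto a proper fully invariant summand \<open>K\<close> has its image in \<open>K\<close>, so it vanishes
    and \<open>K = 0\<close>.  If \<open>M = K \<oplus> L\<close> and \<open>Hom(K, L) = 0\<close>, then for every endomorphism \<open>f\<close> the
    \<open>L\<close>-component of \<open>f\<close> on \<open>K\<close> is zero, which makes \<open>K\<close> fully invariant; so this situation
    is excluded as well.
  \<^item> The image of a central endomorphism is fully invariant, so a central endomorphism is zero or
    surjective (\<open>central_endomorphism_zero_or_surj\<close>).  For multiplication by a central idempotent
    modulo the annihilator, surjectivity makes it the identity.  For a central endomorphism \<open>z\<close> of a
    semi-projective module, surjectivity puts the identity into \<open>S z\<close>, so \<open>z\<close> is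
    invertible, and its inverse is again central.
  \<^item> If \<open>M\<close> is coretractable and \<open>N + K = M\<close> with \<open>K\<close> proper, a non-zero \<open>f\<close> that kills \<open>K\<close> maps
    \<open>M\<close> onto the image of \<open>N\<close>, which lies in \<open>N\<close>: impossible.  For \<open>M/N\<close>, take a non-zero \<open>f\<close>
    that kills the preimage of the given submodule; the endomorphism of \<open>M/N\<close> that it induces is
    zero only if the image of \<open>f\<close> lies in \<open>N\<close>.
  \<^item> If \<open>M\<close> is self-projective, an endomorphism of \<open>M/N\<close> with image in \<open>K/N\<close> lifts to an
    endomorphism of \<open>M\<close> with image in \<open>K\<close>; the latter is zero, hence so is the former.
  \<^item> If \<open>M/N\<close> is Dedekind finite and \<open>f g = 1\<close>, the induced maps satisfy \<open>g f = 1\<close> on \<open>M/N\<close>, so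
    \<open>g f\<close> and \<open>1\<close> agree modulo \<open>N\<close> and are equal.  The converse takes \<open>N = 0\<close>.
\<close>

section \<open>Submodules and homomorphisms\<close>

text \<open>
  Homomorphisms are undefined off the carrier, so closure of the source under its operations is
  needed for the restricted \<open>f\<close> to keep the values of \<open>f\<close> at sums and scalar multiples.
\<close>

lemma mod_homI:
  assumes "\<And>x. x \<in> carrier M \<Longrightarrow> f x \<in> carrier N"
    and "\<And>x y. \<lbrakk>x \<in> carrier M; y \<in> carrier M\<rbrakk> \<Longrightarrow> f (x \<oplus>\<^bsub>M\<^esub> y) = f x \<oplus>\<^bsub>N\<^esub> f y"
    and "\<And>r x. \<lbrakk>r \<in> carrier R; x \<in> carrier M\<rbrakk> \<Longrightarrow> f (r \<odot>\<^bsub>M\<^esub> x) = r \<odot>\<^bsub>N\<^esub> f x"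
    and "\<And>x y. \<lbrakk>x \<in> carrier M; y \<in> carrier M\<rbrakk> \<Longrightarrow> x \<oplus>\<^bsub>M\<^esub> y \<in> carrier M"
    and "\<And>r x. \<lbrakk>r \<in> carrier R; x \<in> carrier M\<rbrakk> \<Longrightarrow> r \<odot>\<^bsub>M\<^esub> x \<in> carrier M"
  shows "(\<lambda>x\<in>carrier M. f x) \<in> mod_hom R M N"
  using assms by (auto simp: mod_hom_def)

lemma mod_hom_closed: "\<lbrakk>f \<in> mod_hom R M N; x \<in> carrier M\<rbrakk> \<Longrightarrow> f x \<in> carrier N"
  and mod_hom_add: "\<lbrakk>f \<in> mod_hom R M N; x \<in> carrier M; y \<in> carrier M\<rbrakk>
    \<Longrightarrow> f (x \<oplus>\<^bsub>M\<^esub> y) = f x \<oplus>\<^bsub>N\<^esub> f y"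
  and mod_hom_smult: "\<lbrakk>f \<in> mod_hom R M N; r \<in> carrier R; x \<in> carrier M\<rbrakk>
    \<Longrightarrow> f (r \<odot>\<^bsub>M\<^esub> x) = r \<odot>\<^bsub>N\<^esub> f x"
  by (auto simp: mod_hom_def)

lemma mod_hom_eqI:
  assumes "f \<in> mod_hom R M N" "g \<in> mod_hom R M N" "\<And>x. x \<in> carrier M \<Longrightarrow> f x = g x"
  shows "f = g"
  using assms by (auto simp: mod_hom_def intro: PiE_ext)

lemma End_ring_simps [simp]:
  "carrier (End_ring R M) = mod_hom R M M"
  "x \<in> carrier M \<Longrightarrow> \<zero>\<^bsub>End_ring R M\<^esub> x = \<zero>\<^bsub>M\<^esub>"
  "x \<in> carrier M \<Longrightarrow> \<one>\<^bsub>End_ring R M\<^esub> x = x"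
  "x \<in> carrier M \<Longrightarrow> (f \<otimes>\<^bsub>End_ring R M\<^esub> g) x = g (f x)"
  by (simp_all add: End_ring_def zero_hom_def)

lemma fully_invariantD:
  assumes "fully_invariant R M K"
  shows "submodule K R M" "\<lbrakk>f \<in> mod_hom R M M; x \<in> K\<rbrakk> \<Longrightarrow> f x \<in> K"
  using assms by (auto simp: fully_invariant_def)

lemma fully_invariantI:
  assumes "submodule K R M" "\<And>f x. \<lbrakk>f \<in> mod_hom R M M; x \<in> K\<rbrakk> \<Longrightarrow> f x \<in> K"
  shows "fully_invariant R M K"
  using assms by (auto simp: fully_invariant_def)

context left_module
begin

lemma smult_l_minus: "\<lbrakk>a \<in> carrier R; x \<in> carrier M\<rbrakk> \<Longrightarrow> (\<ominus> a) \<odot>\<^bsub>M\<^esub> x = \<ominus>\<^bsub>M\<^esub> (a \<odot>\<^bsub>M\<^esub> x)"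
  using smult_l_distr[of "\<ominus> a" a x]
  by (metis M.minus_equality R.l_neg R.add.inv_closed smult_closed smult_l_null)

lemma smult_r_minus: "\<lbrakk>a \<in> carrier R; x \<in> carrier M\<rbrakk> \<Longrightarrow> a \<odot>\<^bsub>M\<^esub> (\<ominus>\<^bsub>M\<^esub> x) = \<ominus>\<^bsub>M\<^esub> (a \<odot>\<^bsub>M\<^esub> x)"
  using smult_r_distr[of a "\<ominus>\<^bsub>M\<^esub> x" x]
  by (metis M.minus_equality M.l_neg M.add.inv_closed smult_closed smult_r_null)

lemma minus_eq_zero_iff:
  assumes "x \<in> carrier M" "y \<in> carrier M"
  shows "x \<ominus>\<^bsub>M\<^esub> y = \<zero>\<^bsub>M\<^esub> \<longleftrightarrow> x = y"
  using assms by (metis M.add.inv_closed M.minus_equality M.minus_minus M.r_neg a_minus_def)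

lemma minus_minus_cancel_left:
  assumes "x \<in> carrier M" "y \<in> carrier M" "z \<in> carrier M"
  shows "(x \<ominus>\<^bsub>M\<^esub> y) \<ominus>\<^bsub>M\<^esub> (x \<ominus>\<^bsub>M\<^esub> z) = z \<ominus>\<^bsub>M\<^esub> y"
proof -
  have "(x \<ominus>\<^bsub>M\<^esub> y) \<ominus>\<^bsub>M\<^esub> (x \<ominus>\<^bsub>M\<^esub> z) = \<ominus>\<^bsub>M\<^esub> x \<oplus>\<^bsub>M\<^esub> (x \<oplus>\<^bsub>M\<^esub> (z \<oplus>\<^bsub>M\<^esub> \<ominus>\<^bsub>M\<^esub> y))"
    using assms
    by (simp add: a_minus_def M.minus_add M.a_ac del: M.r_neg1 M.r_neg2)
  also have "\<dots> = z \<ominus>\<^bsub>M\<^esub> y" using assms by (simp add: a_minus_def M.r_neg1)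
  finally show ?thesis .
qed

lemma submodule_subset: "submodule H R M \<Longrightarrow> x \<in> H \<Longrightarrow> x \<in> carrier M"
  using subgroup.mem_carrier[of H "add_monoid M" x] submodule.axioms(1) by auto

lemma submodule_zero: "submodule H R M \<Longrightarrow> \<zero>\<^bsub>M\<^esub> \<in> H"
  using subgroup.one_closed[of H "add_monoid M"] submodule.axioms(1) by auto

lemma submodule_add: "\<lbrakk>submodule H R M; x \<in> H; y \<in> H\<rbrakk> \<Longrightarrow> x \<oplus>\<^bsub>M\<^esub> y \<in> H"
  using subgroup.m_closed[of H "add_monoid M" x y] submodule.axioms(1) by auto

lemma submodule_uminus: "\<lbrakk>submodule H R M; x \<in> H\<rbrakk> \<Longrightarrow> \<ominus>\<^bsub>M\<^esub> x \<in> H"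
  using subgroup.m_inv_closed[of H "add_monoid M" x] submodule.axioms(1)
  by (auto simp: a_inv_def)

lemma submodule_minus: "\<lbrakk>submodule H R M; x \<in> H; y \<in> H\<rbrakk> \<Longrightarrow> x \<ominus>\<^bsub>M\<^esub> y \<in> H"
  by (simp add: a_minus_def submodule_add submodule_uminus)

lemma submoduleI:
  assumes sub: "\<And>x. x \<in> H \<Longrightarrow> x \<in> carrier M" and zero: "\<zero>\<^bsub>M\<^esub> \<in> H"
    and add: "\<And>x y. \<lbrakk>x \<in> H; y \<in> H\<rbrakk> \<Longrightarrow> x \<oplus>\<^bsub>M\<^esub> y \<in> H"
    and smult: "\<And>r x. \<lbrakk>r \<in> carrier R; x \<in> H\<rbrakk> \<Longrightarrow> r \<odot>\<^bsub>M\<^esub> x \<in> H"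
  shows "submodule H R M"
proof -
  have "\<ominus>\<^bsub>M\<^esub> x \<in> H" if "x \<in> H" for x
    using smult[of "\<ominus> \<one>" x] that sub[OF that] by (simp add: smult_l_minus)
  then have "subgroup H (add_monoid M)"
    using sub zero add by (intro M.add.subgroupI) (auto simp: a_inv_def)
  then show ?thesis using smult by (simp add: submodule_def submodule_axioms_def)
qed

lemma mod_hom_zero:
  assumes "left_module R N" "f \<in> mod_hom R M N"
  shows "f \<zero>\<^bsub>M\<^esub> = \<zero>\<^bsub>N\<^esub>"
proof -
  interpret N: left_module R N by fact
  have "f \<zero>\<^bsub>M\<^esub> = f (\<zero> \<odot>\<^bsub>M\<^esub> \<zero>\<^bsub>M\<^esub>)" by simp
  also have "\<dots> = \<zero> \<odot>\<^bsub>N\<^esub> f \<zero>\<^bsub>M\<^esub>" using assms(2) by (intro mod_hom_smult) auto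
  also have "\<dots> = \<zero>\<^bsub>N\<^esub>" using mod_hom_closed[OF assms(2)] by simp
  finally show ?thesis .
qed

lemma mod_hom_minus:
  assumes "left_module R N" "f \<in> mod_hom R M N" "x \<in> carrier M" "y \<in> carrier M"
  shows "f (x \<ominus>\<^bsub>M\<^esub> y) = f x \<ominus>\<^bsub>N\<^esub> f y"
proof -
  interpret N: left_module R N by fact
  have "f (\<ominus>\<^bsub>M\<^esub> y) = f ((\<ominus> \<one>) \<odot>\<^bsub>M\<^esub> y)" using assms by (simp add: smult_l_minus)
  also have "\<dots> = (\<ominus> \<one>) \<odot>\<^bsub>N\<^esub> f y" using assms(2,4) by (intro mod_hom_smult) auto
  also have "\<dots> = \<ominus>\<^bsub>N\<^esub> f y" using mod_hom_closed[OF assms(2,4)] by (simp add: N.smult_l_minus)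
  finally show ?thesis using assms by (simp add: a_minus_def mod_hom_add)
qed

lemma mod_hom_comp:
  assumes "f \<in> mod_hom R M N" "g \<in> mod_hom R N P"
  shows "(\<lambda>x\<in>carrier M. g (f x)) \<in> mod_hom R M P"
  using assms by (intro mod_homI) (simp_all add: mod_hom_closed mod_hom_add mod_hom_smult)

lemma End_closed:
  "\<zero>\<^bsub>End_ring R M\<^esub> \<in> mod_hom R M M" "\<one>\<^bsub>End_ring R M\<^esub> \<in> mod_hom R M M"
  "\<lbrakk>f \<in> mod_hom R M M; g \<in> mod_hom R M M\<rbrakk> \<Longrightarrow> f \<otimes>\<^bsub>End_ring R M\<^esub> g \<in> mod_hom R M M"
  using ring.ring_simprules(2,6,5)[OF End_ring_ring] by simp_all

lemma mod_hom_diff: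
  assumes "f \<in> mod_hom R M M" "g \<in> mod_hom R M M"
  shows "(\<lambda>x\<in>carrier M. f x \<ominus>\<^bsub>M\<^esub> g x) \<in> mod_hom R M M"
  using assms
  by (intro mod_homI)
    (simp_all add: a_minus_def mod_hom_closed mod_hom_add mod_hom_smult M.minus_add M.a_ac
      smult_r_distr smult_r_minus)

lemma zero_fully_invariant: "fully_invariant R M {\<zero>\<^bsub>M\<^esub>}"
  by (rule fully_invariantI) (auto intro: submoduleI simp: mod_hom_zero[OF left_module_axioms])

lemma image_submodule:
  assumes "f \<in> mod_hom R M M"
  shows "submodule (f ` carrier M) R M"
proof (rule submoduleI)
  show "\<zero>\<^bsub>M\<^esub> \<in> f ` carrier M"
    using mod_hom_zero[OF left_module_axioms assms] by (metis M.zero_closed image_eqI)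
  show "x \<oplus>\<^bsub>M\<^esub> y \<in> f ` carrier M" if "x \<in> f ` carrier M" "y \<in> f ` carrier M" for x y
    using that mod_hom_add[OF assms] by (auto intro!: image_eqI[OF sym])
  show "r \<odot>\<^bsub>M\<^esub> x \<in> f ` carrier M" if "r \<in> carrier R" "x \<in> f ` carrier M" for r x
    using that mod_hom_smult[OF assms] by (auto intro!: image_eqI[OF sym])
qed (auto simp: mod_hom_closed[OF assms])

section \<open>Quotient modules\<close>

lemma abelian_subgroup_submodule:
  assumes "submodule N R M"
  shows "abelian_subgroup N M"
  using submodule.axioms(1)[OF assms]
  by (intro abelian_subgroupI3 additive_subgroup.intro M.abelian_group_axioms)

lemma quot_carrier: "carrier (quot_module M N) = (\<lambda>x. N +>\<^bsub>M\<^esub> x) ` carrier M"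
  by (auto simp: quot_module_def A_RCOSETS_def')

lemma quot_zero: "\<zero>\<^bsub>quot_module M N\<^esub> = N"
  by (simp add: quot_module_def)

lemma quot_map_hom:
  assumes N: "submodule N R M"
  shows "(\<lambda>x\<in>carrier M. N +>\<^bsub>M\<^esub> x) \<in> mod_hom R M (quot_module M N)"
proof -
  interpret S: abelian_subgroup N M by (rule abelian_subgroup_submodule[OF N])
  show ?thesis
    by (rule mod_homI)
      (simp_all add: quot_carrier quot_smult[OF N], simp add: quot_module_def S.a_rcos_sum)
qed

lemma rcos_eq_iff:
  assumes N: "submodule N R M" and "x \<in> carrier M" "y \<in> carrier M"
  shows "N +>\<^bsub>M\<^esub> x = N +>\<^bsub>M\<^esub> y \<longleftrightarrow> x \<ominus>\<^bsub>M\<^esub> y \<in> N"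
proof -
  interpret S: abelian_subgroup N M by (rule abelian_subgroup_submodule[OF N])
  show ?thesis
    using assms S.a_rcos_module[of y x] S.a_rcos_self[of x] S.a_repr_independence'[of x y]
    by (auto simp: a_minus_def)
qed

lemma rcos_eq_submodule_iff:
  assumes N: "submodule N R M" and x: "x \<in> carrier M"
  shows "N +>\<^bsub>M\<^esub> x = N \<longleftrightarrow> x \<in> N"
proof -
  interpret S: abelian_subgroup N M by (rule abelian_subgroup_submodule[OF N])
  show ?thesis using S.a_rcos_const[of x] S.a_rcos_self[OF x] by auto
qed

lemma hom_factors_through_quot:
  assumes N: "submodule N R M" and P: "left_module R P" and f: "f \<in> mod_hom R M P"
    and ker: "\<And>x. x \<in> N \<Longrightarrow> f x = \<zero>\<^bsub>P\<^esub>"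
  obtains F where "F \<in> mod_hom R (quot_module M N) P"
    and "\<And>x. x \<in> carrier M \<Longrightarrow> F (N +>\<^bsub>M\<^esub> x) = f x"
proof -
  interpret P: left_module R P by fact
  let ?Q = "quot_module M N"
  (* f is constant on cosets of N, so its value at any representative defines F. *)
  define s where "s X = (SOME x. x \<in> carrier M \<and> X = N +>\<^bsub>M\<^esub> x)" for X
  have fs: "f (s (N +>\<^bsub>M\<^esub> x)) = f x" if x: "x \<in> carrier M" for x
  proof -
    have s: "s (N +>\<^bsub>M\<^esub> x) \<in> carrier M \<and> N +>\<^bsub>M\<^esub> x = N +>\<^bsub>M\<^esub> s (N +>\<^bsub>M\<^esub> x)"
      unfolding s_def by (rule someI[of _ x]) (simp add: x)
    then have "x \<ominus>\<^bsub>M\<^esub> s (N +>\<^bsub>M\<^esub> x) \<in> N" using rcos_eq_iff[OF N x] by blast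
    then have "f x \<ominus>\<^bsub>P\<^esub> f (s (N +>\<^bsub>M\<^esub> x)) = \<zero>\<^bsub>P\<^esub>"
      using ker mod_hom_minus[OF P f x] s by metis
    then show ?thesis
      using s x mod_hom_closed[OF f] by (simp add: P.minus_eq_zero_iff)
  qed
  have sum: "(N +>\<^bsub>M\<^esub> x) \<oplus>\<^bsub>?Q\<^esub> (N +>\<^bsub>M\<^esub> y) = N +>\<^bsub>M\<^esub> (x \<oplus>\<^bsub>M\<^esub> y)"
    if "x \<in> carrier M" "y \<in> carrier M" for x y
    using mod_hom_add[OF quot_map_hom[OF N] that] that by simp
  have "(\<lambda>X\<in>carrier ?Q. f (s X)) \<in> mod_hom R ?Q P"
    by (rule mod_homI)
      (auto simp: quot_carrier fs sum quot_smult[OF N] mod_hom_closed[OF f] mod_hom_add[OF f]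
        mod_hom_smult[OF f])
  then show ?thesis by (rule that) (simp add: quot_carrier fs)
qed

lemma induced_endomorphism:
  assumes N: "fully_invariant R M N" and f: "f \<in> mod_hom R M M"
  obtains F where "F \<in> mod_hom R (quot_module M N) (quot_module M N)"
    and "\<And>x. x \<in> carrier M \<Longrightarrow> F (N +>\<^bsub>M\<^esub> x) = N +>\<^bsub>M\<^esub> f x"
proof -
  note N' = fully_invariantD(1)[OF N]
  have "(\<lambda>x\<in>carrier M. (\<lambda>x\<in>carrier M. N +>\<^bsub>M\<^esub> x) (f x)) \<in> mod_hom R M (quot_module M N)"
    by (rule mod_hom_comp[OF f quot_map_hom[OF N']])
  then obtain F where F: "F \<in> mod_hom R (quot_module M N) (quot_module M N)"
    and "\<And>x. x \<in> carrier M \<Longrightarrow> F (N +>\<^bsub>M\<^esub> x)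
          = (\<lambda>x\<in>carrier M. (\<lambda>x\<in>carrier M. N +>\<^bsub>M\<^esub> x) (f x)) x"
    by (rule hom_factors_through_quot[OF N' quot_module_left_module[OF N']])
      (use f fully_invariantD(2)[OF N f] submodule_subset[OF N'] in
        \<open>auto simp: quot_zero rcos_eq_submodule_iff[OF N'] mod_hom_closed\<close>)
  then show ?thesis using mod_hom_closed[OF f] by (intro that) auto
qed

lemma submodule_preimage:
  assumes N: "submodule N R M" and K: "submodule K R (quot_module M N)"
  shows "submodule {x \<in> carrier M. N +>\<^bsub>M\<^esub> x \<in> K} R M"
    and "{x \<in> carrier M. N +>\<^bsub>M\<^esub> x \<in> K} = carrier M \<longleftrightarrow> K = carrier (quot_module M N)"
proof -
  let ?P = "{x \<in> carrier M. N +>\<^bsub>M\<^esub> x \<in> K}"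
  interpret Q: left_module R "quot_module M N" by (rule quot_module_left_module[OF N])
  note p = quot_map_hom[OF N]
  have sum: "N +>\<^bsub>M\<^esub> (x \<oplus>\<^bsub>M\<^esub> y) = (N +>\<^bsub>M\<^esub> x) \<oplus>\<^bsub>quot_module M N\<^esub> (N +>\<^bsub>M\<^esub> y)"
    if "x \<in> carrier M" "y \<in> carrier M" for x y
    using mod_hom_add[OF p that] that by simp
  have mem: "x \<in> ?P" if "x \<in> N" for x
    using that rcos_eq_submodule_iff[OF N, of x] submodule_subset[OF N] Q.submodule_zero[OF K]
    by (auto simp: quot_zero)
  show "submodule ?P R M"
    by (rule submoduleI)
      (use mem[OF submodule_zero[OF N]] Q.submodule_add[OF K] submodule.smult_closed[OF K] in
        \<open>auto simp: sum simp flip: quot_smult[OF N]\<close>)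
  show "?P = carrier M \<longleftrightarrow> K = carrier (quot_module M N)"
    using Q.submodule_subset[OF K] by (auto simp: quot_carrier)
qed

section \<open>Projections of a direct sum\<close>

lemma direct_sum_projection:
  assumes KL: "internal_direct_sum R M K L"
  obtains \<pi> where "\<pi> \<in> mod_hom R M M"
    and "\<And>x. x \<in> carrier M \<Longrightarrow> \<pi> x \<in> K"
    and "\<And>x. x \<in> carrier M \<Longrightarrow> x \<ominus>\<^bsub>M\<^esub> \<pi> x \<in> L"
    and "\<And>x. x \<in> K \<Longrightarrow> \<pi> x = x"
proof -
  have K: "submodule K R M" and L: "submodule L R M" and sum: "K <+>\<^bsub>M\<^esub> L = carrier M"
    and int: "K \<inter> L = {\<zero>\<^bsub>M\<^esub>}"
    using KL by (auto simp: internal_direct_sum_def)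
  note Kc = submodule_subset[OF K] and Lc = submodule_subset[OF L]
  (* Any choice of the K-component will do; K \<inter> L = 0 makes it unique, hence additive. *)
  define \<pi> where "\<pi> x = (SOME k. k \<in> K \<and> x \<ominus>\<^bsub>M\<^esub> k \<in> L)" for x
  have pi: "\<pi> x \<in> K \<and> x \<ominus>\<^bsub>M\<^esub> \<pi> x \<in> L" if x: "x \<in> carrier M" for x
  proof -
    from x sum obtain k l where kl: "k \<in> K" "l \<in> L" "x = k \<oplus>\<^bsub>M\<^esub> l"
      unfolding set_add_def' by blast
    then have "x \<ominus>\<^bsub>M\<^esub> k = l"
      using Kc[of k] Lc[of l] M.a_comm[of "k \<oplus>\<^bsub>M\<^esub> l" "\<ominus>\<^bsub>M\<^esub> k"]
      by (simp add: a_minus_def M.r_neg1)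
    with kl have "k \<in> K \<and> x \<ominus>\<^bsub>M\<^esub> k \<in> L" by simp
    then show ?thesis unfolding \<pi>_def by (rule someI)
  qed
  have uniq: "\<pi> x = k" if x: "x \<in> carrier M" and k: "k \<in> K" "x \<ominus>\<^bsub>M\<^esub> k \<in> L" for x k
  proof -
    have c: "k \<in> carrier M" "\<pi> x \<in> carrier M" using k pi[OF x] Kc by auto
    have "(x \<ominus>\<^bsub>M\<^esub> k) \<ominus>\<^bsub>M\<^esub> (x \<ominus>\<^bsub>M\<^esub> \<pi> x) = \<pi> x \<ominus>\<^bsub>M\<^esub> k"
      using x c by (rule minus_minus_cancel_left)
    moreover have "(x \<ominus>\<^bsub>M\<^esub> k) \<ominus>\<^bsub>M\<^esub> (x \<ominus>\<^bsub>M\<^esub> \<pi> x) \<in> L"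
      using pi[OF x] k by (blast intro: submodule_minus[OF L])
    moreover have "\<pi> x \<ominus>\<^bsub>M\<^esub> k \<in> K" using pi[OF x] k by (blast intro: submodule_minus[OF K])
    ultimately have "\<pi> x \<ominus>\<^bsub>M\<^esub> k = \<zero>\<^bsub>M\<^esub>" using int by auto
    then show ?thesis using c by (simp add: minus_eq_zero_iff)
  qed
  have pc: "\<pi> x \<in> carrier M" if "x \<in> carrier M" for x using pi[OF that] Kc by blast
  have "(\<lambda>x\<in>carrier M. \<pi> x) \<in> mod_hom R M M"
  proof (rule mod_homI)
    fix x y assume xy: "x \<in> carrier M" "y \<in> carrier M"
    have "(x \<oplus>\<^bsub>M\<^esub> y) \<ominus>\<^bsub>M\<^esub> (\<pi> x \<oplus>\<^bsub>M\<^esub> \<pi> y) = (x \<ominus>\<^bsub>M\<^esub> \<pi> x) \<oplus>\<^bsub>M\<^esub> (y \<ominus>\<^bsub>M\<^esub> \<pi> y)"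
      using xy pc by (simp add: a_minus_def M.minus_add M.a_ac)
    then show "\<pi> (x \<oplus>\<^bsub>M\<^esub> y) = \<pi> x \<oplus>\<^bsub>M\<^esub> \<pi> y"
      using xy pi by (intro uniq) (auto intro: submodule_add[OF K] submodule_add[OF L])
  next
    fix r x assume rx: "r \<in> carrier R" "x \<in> carrier M"
    have "r \<odot>\<^bsub>M\<^esub> x \<ominus>\<^bsub>M\<^esub> r \<odot>\<^bsub>M\<^esub> \<pi> x = r \<odot>\<^bsub>M\<^esub> (x \<ominus>\<^bsub>M\<^esub> \<pi> x)"
      using rx pc by (simp add: a_minus_def smult_r_distr smult_r_minus)
    then show "\<pi> (r \<odot>\<^bsub>M\<^esub> x) = r \<odot>\<^bsub>M\<^esub> \<pi> x"
      using rx pi by (intro uniq) (auto intro: submodule.smult_closed[OF K] submodule.smult_closed[OF L])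
  qed (auto simp: pc)
  moreover have "\<pi> x = x" if "x \<in> K" for x
    using that Kc[OF that] submodule_zero[OF L] by (intro uniq) (simp_all add: a_minus_def M.r_neg)
  ultimately show ?thesis using pi Kc by (intro that[of "\<lambda>x\<in>carrier M. \<pi> x"]) auto
qed

lemma internal_direct_sum_sym:
  assumes "internal_direct_sum R M K L"
  shows "internal_direct_sum R M L K"
proof -
  have K: "submodule K R M" and L: "submodule L R M"
    using assms by (auto simp: internal_direct_sum_def)
  have "L <+>\<^bsub>M\<^esub> K = K <+>\<^bsub>M\<^esub> L"
    unfolding set_add_def' using M.a_comm submodule_subset[OF K] submodule_subset[OF L]
    by (auto, metis+)
  then show ?thesis using assms by (auto simp: internal_direct_sum_def)
qed

section \<open>Endo-coprime modules\<close>

lemma endo_coprime_eq_zero: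
  assumes "endo_coprime R M" "fully_invariant R M K" "K \<noteq> carrier M"
    and "f \<in> mod_hom R M M" "\<And>x. x \<in> carrier M \<Longrightarrow> f x \<in> K"
  shows "f = \<zero>\<^bsub>End_ring R M\<^esub>"
proof -
  have "f \<in> End_annihilator R M K" using assms(4,5) by (auto simp: End_annihilator_def)
  then show ?thesis using assms(1-3) by (auto simp: endo_coprime_def)
qed

lemma endo_coprime_eqI:
  assumes "endo_coprime R M" "fully_invariant R M K" "K \<noteq> carrier M"
    and f: "f \<in> mod_hom R M M" and g: "g \<in> mod_hom R M M"
    and "\<And>x. x \<in> carrier M \<Longrightarrow> f x \<ominus>\<^bsub>M\<^esub> g x \<in> K"
  shows "f = g"
proof (rule mod_hom_eqI[OF f g])
  fix x assume x: "x \<in> carrier M"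
  have diff: "(\<lambda>x\<in>carrier M. f x \<ominus>\<^bsub>M\<^esub> g x) = \<zero>\<^bsub>End_ring R M\<^esub>"
    using assms(6) by (intro endo_coprime_eq_zero[OF assms(1-3)] mod_hom_diff[OF f g]) auto
  have "f x \<ominus>\<^bsub>M\<^esub> g x = \<zero>\<^bsub>M\<^esub>" using fun_cong[OF diff, of x] x by simp
  then show "f x = g x" using x mod_hom_closed[OF f x] mod_hom_closed[OF g x] by (simp add: minus_eq_zero_iff)
qed

text \<open>The projection onto \<open>K\<close> has image in \<open>K\<close>, so it is zero, yet it fixes \<open>K\<close> pointwise.\<close>

lemma endo_coprime_summand_trivial:
  assumes E: "endo_coprime R M" and K: "fully_invariant R M K" and D: "direct_summand R M K"
    and proper: "K \<noteq> carrier M"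
  shows "K = {\<zero>\<^bsub>M\<^esub>}"
proof -
  obtain L where L: "internal_direct_sum R M K L" using D by (auto simp: direct_summand_def)
  obtain \<pi> where pi: "\<pi> \<in> mod_hom R M M" "\<And>x. x \<in> carrier M \<Longrightarrow> \<pi> x \<in> K"
    "\<And>x. x \<in> K \<Longrightarrow> \<pi> x = x"
    by (rule direct_sum_projection[OF L]) (rule that)
  have "\<pi> = \<zero>\<^bsub>End_ring R M\<^esub>" by (rule endo_coprime_eq_zero[OF E K proper pi(1,2)])
  then have "x = \<zero>\<^bsub>M\<^esub>" if "x \<in> K" for x
    using pi(3)[OF that] submodule_subset[OF fully_invariantD(1)[OF K] that] by simp
  then show ?thesis using submodule_zero[OF fully_invariantD(1)[OF K]] by blast
qed

text \<open>
  Since \<open>z\<close> commutes with every endomorphism, its image is fully invariant, and \<open>z\<close> trivially maps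
  \<open>M\<close> into it; if the image is proper, \<open>z\<close> vanishes.
\<close>

lemma central_endomorphism_zero_or_surj:
  assumes E: "endo_coprime R M" and z: "z \<in> mod_hom R M M"
    and comm: "\<And>f x. \<lbrakk>f \<in> mod_hom R M M; x \<in> carrier M\<rbrakk> \<Longrightarrow> f (z x) = z (f x)"
    and nz: "z \<noteq> \<zero>\<^bsub>End_ring R M\<^esub>"
  shows "z ` carrier M = carrier M"
proof (rule ccontr)
  assume proper: "z ` carrier M \<noteq> carrier M"
  have "fully_invariant R M (z ` carrier M)"
    by (rule fully_invariantI[OF image_submodule[OF z]])
      (auto simp: comm mod_hom_closed)
  from endo_coprime_eq_zero[OF E this proper z] nz show False by blast
qed

text \<open>
  A representative \<open>r\<close> of \<open>e\<close> is central and idempotent only modulo the annihilator, but that is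
  enough for multiplication by \<open>r\<close> to be a central idempotent endomorphism \<open>z\<close> of \<open>M\<close>.  If \<open>z\<close> is
  zero then \<open>r\<close> annihilates \<open>M\<close>; if it is surjective then it is the identity, because an idempotent
  fixes its image.
\<close>

lemma central_idempotent_trivial:
  assumes E: "endo_coprime R M" and e: "central_idempotent (R Quot annihilator R M) e"
  shows "e = \<zero>\<^bsub>R Quot annihilator R M\<^esub> \<or> e = \<one>\<^bsub>R Quot annihilator R M\<^esub>"
proof -
  let ?I = "annihilator R M"
  interpret I: ideal ?I R by (rule annihilator_ideal)
  (* Cosets of the annihilator coincide exactly if their representatives act alike on M. *)
  have eq: "a \<odot>\<^bsub>M\<^esub> x = b \<odot>\<^bsub>M\<^esub> x"
    if "?I +> a = ?I +> b" "a \<in> carrier R" "b \<in> carrier R" "x \<in> carrier M" for a b x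
  proof -
    have "a \<oplus> \<ominus> b \<in> ?I" using that(1-3) I.a_rcos_module[of b a] I.a_rcos_self[of a] by metis
    then have "(a \<oplus> \<ominus> b) \<odot>\<^bsub>M\<^esub> x = \<zero>\<^bsub>M\<^esub>"
      using that(4) unfolding annihilator_def by blast
    then have "a \<odot>\<^bsub>M\<^esub> x \<oplus>\<^bsub>M\<^esub> (\<ominus>\<^bsub>M\<^esub> (b \<odot>\<^bsub>M\<^esub> x)) = \<zero>\<^bsub>M\<^esub>"
      using that(2-4) by (simp add: smult_l_distr smult_l_minus)
    then show ?thesis using that(2-4) by (simp add: minus_eq_zero_iff flip: a_minus_def)
  qed
  have mem: "?I +> a = ?I +> b"
    if a: "a \<in> carrier R" and b: "b \<in> carrier R"
      and ab: "\<And>x. x \<in> carrier M \<Longrightarrow> a \<odot>\<^bsub>M\<^esub> x = b \<odot>\<^bsub>M\<^esub> x" for a b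
  proof -
    have "a \<oplus> \<ominus> b \<in> ?I"
    proof -
      have "(a \<oplus> \<ominus> b) \<odot>\<^bsub>M\<^esub> x = \<zero>\<^bsub>M\<^esub>" if x: "x \<in> carrier M" for x
        using x a b by (simp add: smult_l_distr smult_l_minus ab[OF x] M.r_neg)
      moreover have "a \<oplus> \<ominus> b \<in> carrier R" using a b by (intro R.add.m_closed R.add.inv_closed)
      ultimately show ?thesis unfolding annihilator_def by blast
    qed
    then have "a \<in> ?I +> b" using I.a_rcos_module[of b a] a b by blast
    from I.a_repr_independence'[OF this b] show ?thesis by (rule sym)
  qed
  have Q: "carrier (R Quot ?I) = (\<lambda>a. ?I +> a) ` carrier R"
      "\<one>\<^bsub>R Quot ?I\<^esub> = ?I +> \<one>" "\<zero>\<^bsub>R Quot ?I\<^esub> = ?I +> \<zero>"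
    using I.a_rcos_const[OF I.zero_closed] by (auto simp: FactRing_def A_RCOSETS_def')
  have mult: "(?I +> a) \<otimes>\<^bsub>R Quot ?I\<^esub> (?I +> b) = ?I +> (a \<otimes> b)"
    if "a \<in> carrier R" "b \<in> carrier R" for a b
    using that by (simp add: FactRing_def I.rcoset_mult_add)
  obtain r where r: "r \<in> carrier R" "e = ?I +> r"
    using e by (auto simp: central_idempotent_def center_def Q)
  have comm: "r \<odot>\<^bsub>M\<^esub> (a \<odot>\<^bsub>M\<^esub> x) = a \<odot>\<^bsub>M\<^esub> (r \<odot>\<^bsub>M\<^esub> x)" if "a \<in> carrier R" "x \<in> carrier M" for a x
  proof -
    have "?I +> (r \<otimes> a) = ?I +> (a \<otimes> r)"
      using e r that by (auto simp: central_idempotent_def center_def Q mult)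
    from eq[OF this] show ?thesis using r that by (simp add: smult_assoc1)
  qed
  have idem: "r \<odot>\<^bsub>M\<^esub> (r \<odot>\<^bsub>M\<^esub> x) = r \<odot>\<^bsub>M\<^esub> x" if "x \<in> carrier M" for x
  proof -
    have "?I +> (r \<otimes> r) = ?I +> r"
      using e r by (auto simp: central_idempotent_def mult)
    from eq[OF this] show ?thesis using r that by (simp add: smult_assoc1)
  qed
  define z where "z = (\<lambda>x\<in>carrier M. r \<odot>\<^bsub>M\<^esub> x)"
  have z: "z \<in> mod_hom R M M"
    unfolding z_def by (rule mod_homI) (simp_all add: r smult_r_distr comm)
  show ?thesis
  proof (cases "z = \<zero>\<^bsub>End_ring R M\<^esub>")
    case True
    have "r \<odot>\<^bsub>M\<^esub> x = \<zero> \<odot>\<^bsub>M\<^esub> x" if "x \<in> carrier M" for x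
      using fun_cong[OF True, of x] that by (simp add: z_def)
    then show ?thesis using mem[of r \<zero>] r by (simp add: Q)
  next
    case False
    have surj: "z ` carrier M = carrier M"
      by (rule central_endomorphism_zero_or_surj[OF E z _ False])
        (simp add: z_def r mod_hom_smult mod_hom_closed)
    have "r \<odot>\<^bsub>M\<^esub> x = \<one> \<odot>\<^bsub>M\<^esub> x" if x: "x \<in> carrier M" for x
    proof -
      obtain y where "y \<in> carrier M" "x = r \<odot>\<^bsub>M\<^esub> y"
        using x surj by (force simp: z_def)
      then show ?thesis using idem r by simp
    qed
    then show ?thesis using mem[of r \<one>] r by (simp add: Q)
  qed
qed

text \<open>
  If \<open>Hom(K, L) = 0\<close>, then for an endomorphism \<open>f\<close> the map \<open>f\<close> restricted to \<open>K\<close> and projected to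
  \<open>L\<close> is zero, so \<open>f\<close> preserves \<open>K\<close>.  Thus \<open>K\<close> would be a fully invariant summand.
\<close>

lemma endo_coprime_Hom_complement_nonzero:
  assumes E: "endo_coprime R M" and KL: "internal_direct_sum R M K L"
    and K0: "K \<noteq> {\<zero>\<^bsub>M\<^esub>}" and L0: "L \<noteq> {\<zero>\<^bsub>M\<^esub>}"
  shows "mod_hom R (M\<lparr>carrier := K\<rparr>) (M\<lparr>carrier := L\<rparr>) \<noteq>
    {zero_hom (M\<lparr>carrier := K\<rparr>) (M\<lparr>carrier := L\<rparr>)}" (is "?H \<noteq> {?z}")
proof
  assume H: "?H = {?z}"
  have K: "submodule K R M" and L: "submodule L R M" and int: "K \<inter> L = {\<zero>\<^bsub>M\<^esub>}"
    using KL by (auto simp: internal_direct_sum_def)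
  note Kc = submodule_subset[OF K]
  obtain \<rho> where rho: "\<rho> \<in> mod_hom R M M" "\<And>x. x \<in> carrier M \<Longrightarrow> \<rho> x \<in> L"
    "\<And>x. x \<in> carrier M \<Longrightarrow> x \<ominus>\<^bsub>M\<^esub> \<rho> x \<in> K"
    by (rule direct_sum_projection[OF internal_direct_sum_sym[OF KL]]) (rule that)
  have "fully_invariant R M K"
  proof (rule fully_invariantI[OF K])
    fix f k assume f: "f \<in> mod_hom R M M" and k: "k \<in> K"
    have "(\<lambda>x\<in>carrier (M\<lparr>carrier := K\<rparr>). \<rho> (f x)) \<in> ?H"
      by (rule mod_homI)
        (use f rho(1) Kc in \<open>auto simp: rho(2) mod_hom_closed mod_hom_add mod_hom_smult
          submodule_add[OF K] submodule.smult_closed[OF K]\<close>)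
    then have "(\<lambda>x\<in>K. \<rho> (f x)) = (\<lambda>x\<in>K. \<zero>\<^bsub>M\<^esub>)" by (simp add: H zero_hom_def)
    then have "\<rho> (f k) = \<zero>\<^bsub>M\<^esub>" using k by (metis restrict_apply')
    then show "f k \<in> K" using rho(3)[of "f k"] mod_hom_closed[OF f Kc[OF k]]
      M.minus_equality[of "\<zero>\<^bsub>M\<^esub>" "\<zero>\<^bsub>M\<^esub>"] by (simp add: a_minus_def)
  qed
  moreover have "direct_summand R M K" using KL by (auto simp: direct_summand_def)
  moreover have "K \<noteq> carrier M"
    using int L0 submodule_subset[OF L] submodule_zero[OF L] by blast
  ultimately show False using endo_coprime_summand_trivial[OF E] K0 by blast
qed

text \<open>
  If \<open>f\<close> kills \<open>K\<close> and \<open>N + K = M\<close>, then \<open>f\<close> maps \<open>M\<close> onto the image of \<open>N\<close>, which lies in \<open>N\<close>.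
\<close>

lemma endo_coprime_coretractable_superfluous:
  assumes E: "endo_coprime R M" and C: "coretractable R M"
    and N: "fully_invariant R M N" and proper: "N \<noteq> carrier M"
  shows "superfluous R M N"
  unfolding superfluous_def
proof (intro conjI allI impI)
  show "submodule N R M" by (rule fully_invariantD(1)[OF N])
  fix K assume K: "submodule K R M \<and> N <+>\<^bsub>M\<^esub> K = carrier M"
  show "K = carrier M"
  proof (rule ccontr)
    assume "K \<noteq> carrier M"
    then obtain f where f: "f \<in> mod_hom R M M" "f \<noteq> \<zero>\<^bsub>End_ring R M\<^esub>" "f ` K = {\<zero>\<^bsub>M\<^esub>}"
      using C K unfolding coretractable_def End_ring_simps(1) by blast
    have "f x \<in> N" if "x \<in> carrier M" for x
    proof -
      have "x \<in> N <+>\<^bsub>M\<^esub> K" using that K by simp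
      then obtain n k where nk: "n \<in> N" "k \<in> K" "x = n \<oplus>\<^bsub>M\<^esub> k"
        unfolding set_add_def' by blast
      then have c: "n \<in> carrier M" "k \<in> carrier M"
        using K submodule_subset fully_invariantD(1)[OF N] by auto
      have "f x = f n"
        using f nk c mod_hom_closed[OF f(1)] by (auto simp: mod_hom_add)
      then show ?thesis using fully_invariantD(2)[OF N f(1) nk(1)] by simp
    qed
    from endo_coprime_eq_zero[OF E N proper f(1) this] f(2) show False by blast
  qed
qed

text \<open>
  The required endomorphism of \<open>M/N\<close> is induced by a non-zero \<open>f\<close> that kills the preimage of \<open>K\<close>.
  Endo-coprimeness keeps it non-zero: it vanishes only if \<open>f\<close> maps \<open>M\<close> into \<open>N\<close>.
\<close>

lemma endo_coprime_coretractable_quotient: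
  assumes E: "endo_coprime R M" and C: "coretractable R M"
    and N: "fully_invariant R M N" and proper: "N \<noteq> carrier M"
  shows "coretractable R (quot_module M N)"
  unfolding coretractable_def
proof (intro allI impI, elim conjE)
  let ?Q = "quot_module M N"
  note N' = fully_invariantD(1)[OF N]
  interpret Q: left_module R ?Q by (rule quot_module_left_module[OF N'])
  fix K assume K: "submodule K R ?Q" "K \<noteq> carrier ?Q"
  let ?P = "{x \<in> carrier M. N +>\<^bsub>M\<^esub> x \<in> K}"
  obtain f where f: "f \<in> mod_hom R M M" "f \<noteq> \<zero>\<^bsub>End_ring R M\<^esub>" "f ` ?P = {\<zero>\<^bsub>M\<^esub>}"
    using C submodule_preimage[OF N' K(1)] K(2) unfolding coretractable_def End_ring_simps(1)
    by blast
  obtain F where F: "F \<in> mod_hom R ?Q ?Q" "\<And>x. x \<in> carrier M \<Longrightarrow> F (N +>\<^bsub>M\<^esub> x) = N +>\<^bsub>M\<^esub> f x"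
    by (rule induced_endomorphism[OF N f(1)]) (rule that)
  have "F \<noteq> \<zero>\<^bsub>End_ring R ?Q\<^esub>"
  proof
    assume F0: "F = \<zero>\<^bsub>End_ring R ?Q\<^esub>"
    have "f x \<in> N" if x: "x \<in> carrier M" for x
    proof -
      have "N +>\<^bsub>M\<^esub> x \<in> carrier ?Q" using x by (simp add: quot_carrier)
      then have "N +>\<^bsub>M\<^esub> f x = N"
        using F(2)[OF x] by (simp add: F0 quot_zero)
      then show ?thesis using rcos_eq_submodule_iff[OF N' mod_hom_closed[OF f(1) x]] by simp
    qed
    from endo_coprime_eq_zero[OF E N proper f(1) this] f(2) show False by blast
  qed
  moreover have "F X = \<zero>\<^bsub>?Q\<^esub>" if X: "X \<in> K" for X
  proof -
    obtain x where x: "x \<in> carrier M" "X = N +>\<^bsub>M\<^esub> x"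
      using Q.submodule_subset[OF K(1) X] by (auto simp: quot_carrier)
    then have "f x = \<zero>\<^bsub>M\<^esub>" using f(3) X by blast
    then show ?thesis
      using x F(2) rcos_eq_submodule_iff[OF N'] submodule_zero[OF N'] by (simp add: quot_zero)
  qed
  then have "F ` K = {\<zero>\<^bsub>?Q\<^esub>}" using Q.submodule_zero[OF K(1)] by force
  ultimately show "\<exists>f\<in>carrier (End_ring R ?Q). f \<noteq> \<zero>\<^bsub>End_ring R ?Q\<^esub> \<and> f ` K = {\<zero>\<^bsub>?Q\<^esub>}"
    using F(1) by auto
qed

text \<open>
  The preimage in \<open>M\<close> of a fully invariant submodule of \<open>M/N\<close> is fully invariant, since every
  endomorphism of \<open>M\<close> descends to \<open>M/N\<close>.  Projectivity goes the other way and lifts an endomorphism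
  of \<open>M/N\<close> to \<open>M\<close>, where endo-coprimeness applies.
\<close>

lemma endo_coprime_self_projective_quotient:
  assumes E: "endo_coprime R M" and P: "self_projective R M"
    and N: "fully_invariant R M N"
  shows "endo_coprime R (quot_module M N)"
  unfolding endo_coprime_def
proof (intro allI impI, elim conjE)
  let ?Q = "quot_module M N"
  let ?p = "\<lambda>x\<in>carrier M. N +>\<^bsub>M\<^esub> x"
  note N' = fully_invariantD(1)[OF N]
  interpret Q: left_module R ?Q by (rule quot_module_left_module[OF N'])
  fix K assume K: "fully_invariant R ?Q K" "K \<noteq> carrier ?Q"
  note K' = fully_invariantD(1)[OF K(1)]
  let ?P = "{x \<in> carrier M. N +>\<^bsub>M\<^esub> x \<in> K}"
  have P_inv: "fully_invariant R M ?P"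
  proof (rule fully_invariantI[OF submodule_preimage(1)[OF N' K']])
    fix f x assume f: "f \<in> mod_hom R M M" and x: "x \<in> ?P"
    obtain F where F: "F \<in> mod_hom R ?Q ?Q" "\<And>x. x \<in> carrier M \<Longrightarrow> F (N +>\<^bsub>M\<^esub> x) = N +>\<^bsub>M\<^esub> f x"
      by (rule induced_endomorphism[OF N f]) (rule that)
    from x fully_invariantD(2)[OF K(1) F(1), of "N +>\<^bsub>M\<^esub> x"] show "f x \<in> ?P"
      by (simp add: F(2) mod_hom_closed[OF f])
  qed
  have P_proper: "?P \<noteq> carrier M" using submodule_preimage(2)[OF N' K'] K(2) by simp
  have "G = \<zero>\<^bsub>End_ring R ?Q\<^esub>" if G: "G \<in> mod_hom R ?Q ?Q" "G ` carrier ?Q \<subseteq> K" for G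
  proof -
    have surj: "?p ` carrier M = carrier ?Q" by (simp add: quot_carrier)
    have pG: "(\<lambda>x\<in>carrier M. G (?p x)) \<in> mod_hom R M ?Q"
      by (rule mod_hom_comp[OF quot_map_hom[OF N'] G(1)])
    obtain h where h: "h \<in> mod_hom R M M"
        "\<forall>x\<in>carrier M. ?p (h x) = (\<lambda>x\<in>carrier M. G (?p x)) x"
      using P quot_map_hom[OF N'] surj pG quot_module_left_module[OF N']
      unfolding self_projective_def rel_projective_def by meson
    then have hG: "N +>\<^bsub>M\<^esub> h x = G (N +>\<^bsub>M\<^esub> x)" if "x \<in> carrier M" for x
      using that mod_hom_closed[OF h(1) that] by auto
    have "h x \<in> ?P" if "x \<in> carrier M" for x
      using that G(2) mod_hom_closed[OF h(1) that] by (auto simp: hG quot_carrier)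
    then have "h = \<zero>\<^bsub>End_ring R M\<^esub>" by (rule endo_coprime_eq_zero[OF E P_inv P_proper h(1)])
    then have "G (N +>\<^bsub>M\<^esub> x) = N" if "x \<in> carrier M" for x
      using that hG[OF that] rcos_eq_submodule_iff[OF N' M.zero_closed] submodule_zero[OF N'] by simp
    then show ?thesis
      by (intro mod_hom_eqI[OF G(1) Q.End_closed(1)]) (auto simp: quot_carrier quot_zero)
  qed
  moreover have "\<zero>\<^bsub>End_ring R ?Q\<^esub> \<in> End_annihilator R ?Q K"
    using Q.End_closed(1) Q.submodule_zero[OF K'] by (auto simp: End_annihilator_def)
  ultimately show "End_annihilator R ?Q K = {\<zero>\<^bsub>End_ring R ?Q\<^esub>}"
    unfolding End_annihilator_def End_ring_simps(1) by blast
qed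

lemma End_mult_eq_one_iff:
  assumes "f \<in> mod_hom R M M" "g \<in> mod_hom R M M"
  shows "f \<otimes>\<^bsub>End_ring R M\<^esub> g = \<one>\<^bsub>End_ring R M\<^esub> \<longleftrightarrow> (\<forall>x\<in>carrier M. g (f x) = x)"
proof (intro iffI ballI)
  fix x assume "f \<otimes>\<^bsub>End_ring R M\<^esub> g = \<one>\<^bsub>End_ring R M\<^esub>" and x: "x \<in> carrier M"
  from fun_cong[OF this(1), of x] x show "g (f x) = x" by simp
next
  assume "\<forall>x\<in>carrier M. g (f x) = x"
  then show "f \<otimes>\<^bsub>End_ring R M\<^esub> g = \<one>\<^bsub>End_ring R M\<^esub>"
    using assms by (intro mod_hom_eqI[OF End_closed(3) End_closed(2)]) auto
qed

lemma dedekind_finite_iff: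
  "dedekind_finite R M \<longleftrightarrow>
    (\<forall>f\<in>mod_hom R M M. \<forall>g\<in>mod_hom R M M.
      (\<forall>x\<in>carrier M. g (f x) = x) \<longrightarrow> (\<forall>x\<in>carrier M. f (g x) = x))"
  by (simp add: dedekind_finite_def dedekind_finite_ring_def End_mult_eq_one_iff)

text \<open>
  The coset map \<open>M \<rightarrow> M/0\<close> is an isomorphism with inverse \<open>q\<close>; conjugation with it carries
  endomorphisms of \<open>M/0\<close> to endomorphisms of \<open>M\<close>.
\<close>

lemma dedekind_finite_quot_zero:
  assumes D: "dedekind_finite R M"
  shows "dedekind_finite R (quot_module M {\<zero>\<^bsub>M\<^esub>})"
proof -
  let ?N = "{\<zero>\<^bsub>M\<^esub>}"
  let ?Q = "quot_module M ?N"
  let ?p = "\<lambda>x\<in>carrier M. ?N +>\<^bsub>M\<^esub> x"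
  have N: "submodule ?N R M" by (rule submoduleI) auto
  interpret Q: left_module R ?Q by (rule quot_module_left_module[OF N])
  obtain q where q: "q \<in> mod_hom R ?Q M"
    and "\<And>x. x \<in> carrier M \<Longrightarrow> q (?N +>\<^bsub>M\<^esub> x) = \<one>\<^bsub>End_ring R M\<^esub> x"
    by (rule hom_factors_through_quot[OF N left_module_axioms End_closed(2)]) auto
  then have qp: "q (?N +>\<^bsub>M\<^esub> x) = x" if "x \<in> carrier M" for x using that by simp
  have pq: "?N +>\<^bsub>M\<^esub> q X = X" if X: "X \<in> carrier ?Q" for X
  proof -
    obtain x where x: "X = ?N +>\<^bsub>M\<^esub> x" "x \<in> carrier M"
      using X[unfolded quot_carrier] by (rule imageE) (rule that)
    show ?thesis unfolding x(1) qp[OF x(2)] ..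
  qed
  have conj: "(\<lambda>x\<in>carrier M. q (F (?N +>\<^bsub>M\<^esub> x))) \<in> mod_hom R M M" if "F \<in> mod_hom R ?Q ?Q" for F
  proof -
    have "(\<lambda>x\<in>carrier M. q ((\<lambda>x\<in>carrier M. F (?p x)) x)) \<in> mod_hom R M M"
      by (rule mod_hom_comp[OF mod_hom_comp[OF quot_map_hom[OF N] that] q])
    moreover have "(\<lambda>x\<in>carrier M. q ((\<lambda>x\<in>carrier M. F (?p x)) x))
        = (\<lambda>x\<in>carrier M. q (F (?N +>\<^bsub>M\<^esub> x)))" by auto
    ultimately show ?thesis by simp
  qed
  show ?thesis
    unfolding Q.dedekind_finite_iff
  proof (intro ballI impI)
    fix F G X
    assume F: "F \<in> mod_hom R ?Q ?Q" and G: "G \<in> mod_hom R ?Q ?Q"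
      and GF: "\<forall>X\<in>carrier ?Q. G (F X) = X" and X: "X \<in> carrier ?Q"
    let ?f = "\<lambda>x\<in>carrier M. q (F (?N +>\<^bsub>M\<^esub> x))"
    let ?g = "\<lambda>x\<in>carrier M. q (G (?N +>\<^bsub>M\<^esub> x))"
    have pc: "?N +>\<^bsub>M\<^esub> x \<in> carrier ?Q" if "x \<in> carrier M" for x
      using that by (simp add: quot_carrier)
    note c = pc mod_hom_closed[OF F] mod_hom_closed[OF G] mod_hom_closed[OF q]
    have "\<forall>x\<in>carrier M. ?g (?f x) = x" by (simp add: c pq GF qp)
    then have fg: "\<forall>x\<in>carrier M. ?f (?g x) = x"
      using D conj[OF F] conj[OF G] unfolding dedekind_finite_iff by blast
    have "q (F (G (?N +>\<^bsub>M\<^esub> q X))) = q X"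
      using bspec[OF fg, of "q X"] X by (simp add: c pq)
    then have "?N +>\<^bsub>M\<^esub> q (F (G X)) = ?N +>\<^bsub>M\<^esub> q X" using X by (simp add: pq)
    then show "F (G X) = X" using X by (simp add: c pq)
  qed
qed

text \<open>
  A one-sided inverse pair on \<open>M\<close> descends to \<open>M/N\<close>, where it becomes two-sided; so the other
  composite on \<open>M\<close> agrees with the identity modulo \<open>N\<close>, which forces equality.
\<close>

lemma endo_coprime_dedekind_finite_lift:
  assumes E: "endo_coprime R M" and N: "fully_invariant R M N" and proper: "N \<noteq> carrier M"
    and D: "dedekind_finite R (quot_module M N)"
  shows "dedekind_finite R M"
  unfolding dedekind_finite_iff
proof (intro ballI impI)
  let ?Q = "quot_module M N"
  note N' = fully_invariantD(1)[OF N]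
  interpret Q: left_module R ?Q by (rule quot_module_left_module[OF N'])
  fix f g x
  assume f: "f \<in> mod_hom R M M" and g: "g \<in> mod_hom R M M"
    and gf: "\<forall>x\<in>carrier M. g (f x) = x" and x: "x \<in> carrier M"
  note c = mod_hom_closed[OF f] mod_hom_closed[OF g]
  obtain F where F: "F \<in> mod_hom R ?Q ?Q" "\<And>x. x \<in> carrier M \<Longrightarrow> F (N +>\<^bsub>M\<^esub> x) = N +>\<^bsub>M\<^esub> f x"
    by (rule induced_endomorphism[OF N f]) (rule that)
  obtain G where G: "G \<in> mod_hom R ?Q ?Q" "\<And>x. x \<in> carrier M \<Longrightarrow> G (N +>\<^bsub>M\<^esub> x) = N +>\<^bsub>M\<^esub> g x"
    by (rule induced_endomorphism[OF N g]) (rule that)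
  have "\<forall>X\<in>carrier ?Q. G (F X) = X"
    using gf by (auto simp: quot_carrier F(2) G(2) c)
  then have FG: "\<forall>X\<in>carrier ?Q. F (G X) = X"
    using D F(1) G(1) unfolding Q.dedekind_finite_iff by blast
  have "N +>\<^bsub>M\<^esub> f (g y) = N +>\<^bsub>M\<^esub> y" if "y \<in> carrier M" for y
    using FG that by (auto simp: quot_carrier F(2) G(2) c)
  then have "g \<otimes>\<^bsub>End_ring R M\<^esub> f = \<one>\<^bsub>End_ring R M\<^esub>"
    using rcos_eq_iff[OF N'] c
    by (intro endo_coprime_eqI[OF E N proper End_closed(3)[OF g f] End_closed(2)]) auto
  then show "f (g x) = x" using x End_mult_eq_one_iff[OF g f] by blast
qed

end

section \<open>The center of the endomorphism ring\<close>

lemma center_subring: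
  assumes "ring S"
  shows "subring (center S) S"
proof -
  interpret S: ring S by fact
  have centerI: "z \<in> center S"
    if "z \<in> carrier S" "\<And>s. s \<in> carrier S \<Longrightarrow> z \<otimes>\<^bsub>S\<^esub> s = s \<otimes>\<^bsub>S\<^esub> z" for z
    using that by (simp add: center_def)
  have carr: "z \<in> carrier S" and comm: "s \<in> carrier S \<Longrightarrow> z \<otimes>\<^bsub>S\<^esub> s = s \<otimes>\<^bsub>S\<^esub> z"
    if "z \<in> center S" for z s
    using that unfolding center_def by blast+
  show ?thesis
  proof (rule S.subringI)
    show "center S \<subseteq> carrier S" using carr by blast
    show "\<one>\<^bsub>S\<^esub> \<in> center S" by (rule centerI) simp_all
    show "\<ominus>\<^bsub>S\<^esub> x \<in> center S" if "x \<in> center S" for x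
      by (rule centerI) (simp_all add: carr[OF that] S.l_minus S.r_minus comm[OF that])
    fix x y assume x: "x \<in> center S" and y: "y \<in> center S"
    show "x \<oplus>\<^bsub>S\<^esub> y \<in> center S"
      by (rule centerI) (simp_all only: S.a_closed S.l_distr S.r_distr carr[OF x] carr[OF y] comm[OF x] comm[OF y])
    show "x \<otimes>\<^bsub>S\<^esub> y \<in> center S"
    proof (rule centerI)
      fix s assume s: "s \<in> carrier S"
      have "x \<otimes>\<^bsub>S\<^esub> y \<otimes>\<^bsub>S\<^esub> s = x \<otimes>\<^bsub>S\<^esub> (s \<otimes>\<^bsub>S\<^esub> y)"
        using carr[OF x] carr[OF y] s by (simp only: S.m_assoc comm[OF y s])
      also have "\<dots> = s \<otimes>\<^bsub>S\<^esub> (x \<otimes>\<^bsub>S\<^esub> y)"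
        using carr[OF x] carr[OF y] s by (simp only: comm[OF x s] flip: S.m_assoc)
      finally show "x \<otimes>\<^bsub>S\<^esub> y \<otimes>\<^bsub>S\<^esub> s = s \<otimes>\<^bsub>S\<^esub> (x \<otimes>\<^bsub>S\<^esub> y)" .
    qed (simp add: carr[OF x] carr[OF y])
  qed
qed

context left_module
begin

text \<open>
  Surjectivity of a central \<open>z \<noteq> 0\<close> says that the identity has its image in that of \<open>z\<close>;
  semi-projectivity turns this inclusion of images into a factorisation \<open>1 = s z\<close>.
\<close>

lemma endo_coprime_semi_projective_center_field:
  assumes E: "endo_coprime R M" and P: "semi_projective R M" and nz: "carrier M \<noteq> {\<zero>\<^bsub>M\<^esub>}"
  shows "field ((End_ring R M)\<lparr>carrier := center (End_ring R M)\<rparr>)"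
proof -
  let ?S = "End_ring R M"
  interpret S: ring ?S by (rule End_ring_ring)
  have Z: "center ?S \<subseteq> carrier ?S" by (auto simp: center_def)
  have "subcring (center ?S) ?S"
    by (rule S.subcringI[OF center_subring[OF S.ring_axioms]]) (unfold center_def, blast)
  then interpret C: cring "?S\<lparr>carrier := center ?S\<rparr>" using S.subcring_iff[OF Z] by simp
  show ?thesis
  proof (rule C.cring_fieldI2)
    obtain x where "x \<in> carrier M" "x \<noteq> \<zero>\<^bsub>M\<^esub>" using nz M.zero_closed by blast
    then have "\<zero>\<^bsub>?S\<^esub> x \<noteq> \<one>\<^bsub>?S\<^esub> x" by simp
    then have "\<zero>\<^bsub>?S\<^esub> \<noteq> \<one>\<^bsub>?S\<^esub>" by (rule contrapos_nn) simp
    then show "\<zero>\<^bsub>?S\<lparr>carrier := center ?S\<rparr>\<^esub> \<noteq> \<one>\<^bsub>?S\<lparr>carrier := center ?S\<rparr>\<^esub>" by simp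
    fix z assume "z \<in> carrier (?S\<lparr>carrier := center ?S\<rparr>)" "z \<noteq> \<zero>\<^bsub>?S\<lparr>carrier := center ?S\<rparr>\<^esub>"
    then have z: "z \<in> carrier ?S" "z \<noteq> \<zero>\<^bsub>?S\<^esub>" and comm: "\<And>f. f \<in> carrier ?S \<Longrightarrow> z \<otimes>\<^bsub>?S\<^esub> f = f \<otimes>\<^bsub>?S\<^esub> z"
      by (auto simp: center_def)
    have "z ` carrier M = carrier M"
    proof (rule central_endomorphism_zero_or_surj[OF E _ _ z(2)])
      show "z \<in> mod_hom R M M" using z by simp
      fix f x assume "f \<in> mod_hom R M M" "x \<in> carrier M"
      then show "f (z x) = z (f x)" using fun_cong[OF comm[of f], of x] by simp
    qed
    then have "\<one>\<^bsub>?S\<^esub> \<in> {g \<in> carrier ?S. g ` carrier M \<subseteq> z ` carrier M}"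
      by (auto simp: End_closed)
    also have "\<dots> = {s \<otimes>\<^bsub>?S\<^esub> z | s. s \<in> carrier ?S}"
      using P z(1) unfolding semi_projective_def by blast
    finally obtain s where s: "s \<in> carrier ?S" "s \<otimes>\<^bsub>?S\<^esub> z = \<one>\<^bsub>?S\<^esub>" by force
    have zs: "z \<otimes>\<^bsub>?S\<^esub> s = \<one>\<^bsub>?S\<^esub>" using comm[OF s(1)] s(2) by simp
    (* The inverse of a central element is central: s f = s f z s = s z f s = f s. *)
    have "s \<otimes>\<^bsub>?S\<^esub> f = f \<otimes>\<^bsub>?S\<^esub> s" if f: "f \<in> carrier ?S" for f
    proof -
      have "s \<otimes>\<^bsub>?S\<^esub> f = s \<otimes>\<^bsub>?S\<^esub> f \<otimes>\<^bsub>?S\<^esub> (z \<otimes>\<^bsub>?S\<^esub> s)" by (simp only: zs S.r_one S.m_closed s f)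
      also have "\<dots> = s \<otimes>\<^bsub>?S\<^esub> (f \<otimes>\<^bsub>?S\<^esub> z) \<otimes>\<^bsub>?S\<^esub> s"
        by (simp only: S.m_assoc S.m_closed s(1) f z(1))
      also have "\<dots> = s \<otimes>\<^bsub>?S\<^esub> (z \<otimes>\<^bsub>?S\<^esub> f) \<otimes>\<^bsub>?S\<^esub> s" by (simp only: comm[OF f])
      also have "\<dots> = (s \<otimes>\<^bsub>?S\<^esub> z) \<otimes>\<^bsub>?S\<^esub> (f \<otimes>\<^bsub>?S\<^esub> s)"
        by (simp only: S.m_assoc S.m_closed s(1) f z(1))
      also have "\<dots> = f \<otimes>\<^bsub>?S\<^esub> s" by (simp only: s(2) S.l_one S.m_closed s(1) f)
      finally show ?thesis .
    qed
    then have "s \<in> center ?S" using s(1) by (simp add: center_def)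
    then show "\<exists>b\<in>carrier (?S\<lparr>carrier := center ?S\<rparr>).
        z \<otimes>\<^bsub>?S\<lparr>carrier := center ?S\<rparr>\<^esub> b = \<one>\<^bsub>?S\<lparr>carrier := center ?S\<rparr>\<^esub>"
      using zs by (intro bexI[of _ s]) simp_all
  qed
qed

end

theorem proposition2p12:
  fixes R :: "('a, 'r) ring_scheme" and M :: "('a, 'b, 'm) module_scheme"
  assumes "\<one>\<^bsub>R\<^esub> \<noteq> \<zero>\<^bsub>R\<^esub>"
    and "left_module R M"
    and "carrier M \<noteq> {\<zero>\<^bsub>M\<^esub>}"
    and "endo_coprime R M"
  shows "((\<nexists>K. fully_invariant R M K \<and> direct_summand R M K \<and> K \<noteq> {\<zero>\<^bsub>M\<^esub>} \<and> K \<noteq> carrier M)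
          \<and> (\<forall>e. central_idempotent (R Quot annihilator R M) e \<longrightarrow>
                e = \<zero>\<^bsub>R Quot annihilator R M\<^esub> \<or> e = \<one>\<^bsub>R Quot annihilator R M\<^esub>))
    \<and> (\<forall>K L. internal_direct_sum R M K L \<and> K \<noteq> {\<zero>\<^bsub>M\<^esub>} \<and> L \<noteq> {\<zero>\<^bsub>M\<^esub>} \<longrightarrow>
          mod_hom R (M\<lparr>carrier := K\<rparr>) (M\<lparr>carrier := L\<rparr>) \<noteq>
            {zero_hom (M\<lparr>carrier := K\<rparr>) (M\<lparr>carrier := L\<rparr>)})
    \<and> (coretractable R M \<longrightarrow>
          (\<forall>N. fully_invariant R M N \<and> N \<noteq> carrier M \<longrightarrow>
            superfluous R M N \<and> coretractable R (quot_module M N)))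
    \<and> (self_projective R M \<longrightarrow>
          (\<forall>N. fully_invariant R M N \<and> N \<noteq> carrier M \<longrightarrow> endo_coprime R (quot_module M N)))
    \<and> (dedekind_finite R M \<longleftrightarrow>
          (\<exists>N. fully_invariant R M N \<and> N \<noteq> carrier M \<and> dedekind_finite R (quot_module M N)))
    \<and> (semi_projective R M \<longrightarrow>
          field ((End_ring R M)\<lparr>carrier := center (End_ring R M)\<rparr>))"
proof -
  interpret left_module R M by fact
  note E = assms(4)
  show ?thesis
  proof (intro conjI allI impI, goal_cases)
    case 1
    show ?case using endo_coprime_summand_trivial[OF E] by blast
  next
    case (2 e)
    then show ?case by (rule central_idempotent_trivial[OF E])
  next
    case (3 K L)
    then show ?case using endo_coprime_Hom_complement_nonzero[OF E] by blast
  next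
    case (4 N)
    then show ?case using endo_coprime_coretractable_superfluous[OF E] by blast
  next
    case (5 N)
    then show ?case using endo_coprime_coretractable_quotient[OF E] by blast
  next
    case (6 N)
    then show ?case using endo_coprime_self_projective_quotient[OF E] by blast
  next
    case 7
    show ?case
      using zero_fully_invariant assms(3) dedekind_finite_quot_zero
        endo_coprime_dedekind_finite_lift[OF E] by metis
  next
    case 8
    then show ?case by (rule endo_coprime_semi_projective_center_field[OF E _ assms(3)])
  qed
qed

end
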